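(* Let $K$ be an algebraically closed field of characteristic zero, let $k\ge 1$ be an integer, and let $g,m,\varphi$ be functions of the variables $x_1,\dots,x_n$ (formal power series over $K$) such that $f=g+m\varphi^k$ satisfies $f(0)=0$. Then the function $$f=g+m\varphi^k$$ is stably equivalent to $$-uv+u\varphi+mv^k+g,$$ where $u,v$ are two new variables.
   Context: Two functions are ($R$-)equivalent if they can be turned into each other under the action of invertible coordinate changes. Two functions, possibly in different numbers of variables, are stably equivalent if they become equivalent after the addition of non-degenerate quadratic forms in additional variables.
   Formalization: The new function is expanded at x=0, u=k·m(0)φ(0)^(k-1), v=φ(0); at the origin the claim is made only if φ(0)=0 and (k≥2 or m(0)=0). Otherwise it can fail there: k=1, m=1, φ=x², g=0 gives f=x², but -uv+ux²+v has a linear term. *)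

theory Defs
  imports Complex_Main "HOL-Library.Poly_Mapping" "HOL-Library.FuncSet"
    "HOL-Computational_Algebra.Polynomial"
begin

text \<open>
  Formal power series in the variables $x_0, x_1, x_2, \ldots$; a monomial is its finitely
  supported exponent vector. The series in $x_0, \ldots, x_{n-1}$ only form
  the set \<open>mps_in n\<close> below, so that the number of variables is an ordinary natural number.
\<close>

typedef 'a mps = "UNIV :: ((nat \<Rightarrow>\<^sub>0 nat) \<Rightarrow> 'a) set"
  morphisms mps_coeff Abs_mps ..

setup_lifting type_definition_mps

lemma mps_eqI: "(\<And>\<alpha>. mps_coeff f \<alpha> = mps_coeff g \<alpha>) \<Longrightarrow> f = g"
  by transfer auto

lemma finite_exponent_splittings: "finite {(\<alpha>, \<beta>). \<alpha> + \<beta> = (\<gamma> :: nat \<Rightarrow>\<^sub>0 nat)}"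
proof -
  let ?D = "{\<alpha>. \<forall>i. Poly_Mapping.lookup \<alpha> i \<le> Poly_Mapping.lookup \<gamma> i}"
  let ?F = "{f. \<forall>i. (i \<in> Poly_Mapping.keys \<gamma> \<longrightarrow> f i \<in> {..Max (range (Poly_Mapping.lookup \<gamma>))})
                  \<and> (i \<notin> Poly_Mapping.keys \<gamma> \<longrightarrow> f i = 0)}"
  have fin: "finite (range (Poly_Mapping.lookup \<gamma>))"
  proof -
    have "range (Poly_Mapping.lookup \<gamma>)
        \<subseteq> insert 0 (Poly_Mapping.lookup \<gamma> ` Poly_Mapping.keys \<gamma>)"
      by (auto simp: in_keys_iff)
    then show ?thesis by (rule finite_subset) simp
  qed
  have "Poly_Mapping.lookup ` ?D \<subseteq> ?F"
  proof clarify
    fix \<alpha> i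
    assume le: "\<forall>i. Poly_Mapping.lookup \<alpha> i \<le> Poly_Mapping.lookup \<gamma> i"
    have "Poly_Mapping.lookup \<alpha> i \<le> Max (range (Poly_Mapping.lookup \<gamma>))"
      using le fin by (meson Max_ge order_trans rangeI)
    moreover have "i \<notin> Poly_Mapping.keys \<gamma> \<Longrightarrow> Poly_Mapping.lookup \<alpha> i = 0"
      using le by (metis in_keys_iff le_zero_eq)
    ultimately show "(i \<in> Poly_Mapping.keys \<gamma> \<longrightarrow> Poly_Mapping.lookup \<alpha> i \<in> {..Max (range (Poly_Mapping.lookup \<gamma>))})
                  \<and> (i \<notin> Poly_Mapping.keys \<gamma> \<longrightarrow> Poly_Mapping.lookup \<alpha> i = 0)"
      by simp
  qed
  moreover have "finite ?F"
    by (rule finite_set_of_finite_funs) auto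
  ultimately have "finite (Poly_Mapping.lookup ` ?D)"
    by (rule finite_subset)
  then have "finite ?D"
    by (rule finite_imageD) (auto intro: inj_onI simp: lookup_inject)
  moreover have "{(\<alpha>, \<beta>). \<alpha> + \<beta> = \<gamma>} \<subseteq> ?D \<times> ?D"
    by (auto simp: lookup_add)
  ultimately show ?thesis
    by (meson finite_SigmaI finite_subset)
qed

instantiation mps :: (comm_ring_1) comm_ring_1
begin

lift_definition zero_mps :: "'a mps" is "\<lambda>_. 0" .
lift_definition one_mps :: "'a mps" is "\<lambda>\<alpha>. if \<alpha> = 0 then 1 else 0" .
lift_definition plus_mps :: "'a mps \<Rightarrow> 'a mps \<Rightarrow> 'a mps" is "\<lambda>f g \<alpha>. f \<alpha> + g \<alpha>" .
lift_definition minus_mps :: "'a mps \<Rightarrow> 'a mps \<Rightarrow> 'a mps" is "\<lambda>f g \<alpha>. f \<alpha> - g \<alpha>" .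
lift_definition uminus_mps :: "'a mps \<Rightarrow> 'a mps" is "\<lambda>f \<alpha>. - f \<alpha>" .
lift_definition times_mps :: "'a mps \<Rightarrow> 'a mps \<Rightarrow> 'a mps" is
  "\<lambda>f g \<gamma>. \<Sum>(\<alpha>, \<beta>) \<in> {(\<alpha>, \<beta>). \<alpha> + \<beta> = \<gamma>}. f \<alpha> * g \<beta>" .

instance
proof
  fix f g h :: "'a mps"
  show "f + g + h = f + (g + h)" by transfer (simp add: add.assoc)
  show "f + g = g + f" by transfer (simp add: add.commute)
  show "0 + f = f" by transfer simp
  show "- f + f = 0" by transfer simp
  show "f - g = f + - g" by transfer simp
  show "(0 :: 'a mps) \<noteq> 1" by transfer (metis zero_neq_one)
  show "(f + g) * h = f * h + g * h"
    by transfer (simp add: distrib_right sum.distrib case_prod_unfold)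
  show "f * g = g * f"
  proof (transfer, rule ext)
    fix f g :: "(nat \<Rightarrow>\<^sub>0 nat) \<Rightarrow> 'a" and \<gamma>
    show "(\<Sum>(\<alpha>, \<beta>) \<in> {(\<alpha>, \<beta>). \<alpha> + \<beta> = \<gamma>}. f \<alpha> * g \<beta>)
        = (\<Sum>(\<alpha>, \<beta>) \<in> {(\<alpha>, \<beta>). \<alpha> + \<beta> = \<gamma>}. g \<alpha> * f \<beta>)"
      by (rule sum.reindex_bij_witness[of _ prod.swap prod.swap])
        (auto simp: add.commute mult.commute)
  qed
  show "1 * f = f"
  proof (transfer, rule ext)
    fix f :: "(nat \<Rightarrow>\<^sub>0 nat) \<Rightarrow> 'a" and \<gamma>
    have "(\<Sum>(\<alpha>, \<beta>) \<in> {(\<alpha>, \<beta>). \<alpha> + \<beta> = \<gamma>}. (if \<alpha> = 0 then 1 else 0) * f \<beta>)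
        = (\<Sum>(\<alpha>, \<beta>) \<in> {(0 :: nat \<Rightarrow>\<^sub>0 nat, \<gamma>)}. (if \<alpha> = 0 then 1 else 0) * f \<beta>)"
      by (rule sum.mono_neutral_right) (auto simp: finite_exponent_splittings split: if_splits)
    then show "(\<Sum>(\<alpha>, \<beta>) \<in> {(\<alpha>, \<beta>). \<alpha> + \<beta> = \<gamma>}. (if \<alpha> = 0 then 1 else 0) * f \<beta>) = f \<gamma>"
      by simp
  qed
  show "f * g * h = f * (g * h)"
  proof (transfer, rule ext)
    fix f g h :: "(nat \<Rightarrow>\<^sub>0 nat) \<Rightarrow> 'a" and \<delta> :: "nat \<Rightarrow>\<^sub>0 nat"
    let ?S = "\<lambda>\<gamma> :: nat \<Rightarrow>\<^sub>0 nat. {(\<alpha>, \<beta>). \<alpha> + \<beta> = \<gamma>}"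
    have fin: "finite (?S \<gamma>)" for \<gamma> by (rule finite_exponent_splittings)
    have "(\<Sum>(\<rho>, \<gamma>) \<in> ?S \<delta>. (\<Sum>(\<alpha>, \<beta>) \<in> ?S \<rho>. f \<alpha> * g \<beta>) * h \<gamma>)
        = (\<Sum>p \<in> ?S \<delta>. \<Sum>q \<in> ?S (fst p). f (fst q) * g (snd q) * h (snd p))"
      by (simp add: sum_distrib_right case_prod_unfold)
    also have "\<dots> = (\<Sum>(p, q) \<in> Sigma (?S \<delta>) (\<lambda>p. ?S (fst p)). f (fst q) * g (snd q) * h (snd p))"
      by (rule sum.Sigma) (use fin in auto)
    also have "\<dots> = (\<Sum>(p, q) \<in> Sigma (?S \<delta>) (\<lambda>p. ?S (snd p)). f (fst p) * (g (fst q) * h (snd q)))"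
      by (rule sum.reindex_bij_witness
          [of _ "\<lambda>((a, _), (b, c)). ((a + b, c), (a, b))" "\<lambda>((_, c), (a, b)). ((a, b + c), (b, c))"])
        (auto simp: add.assoc mult.assoc)
    also have "\<dots> = (\<Sum>p \<in> ?S \<delta>. \<Sum>q \<in> ?S (snd p). f (fst p) * (g (fst q) * h (snd q)))"
      by (rule sum.Sigma[symmetric]) (use fin in auto)
    also have "\<dots> = (\<Sum>(\<alpha>, \<rho>) \<in> ?S \<delta>. f \<alpha> * (\<Sum>(\<beta>, \<gamma>) \<in> ?S \<rho>. g \<beta> * h \<gamma>))"
      by (simp add: sum_distrib_left case_prod_unfold)
    finally show "(\<Sum>(\<rho>, \<gamma>) \<in> ?S \<delta>. (\<Sum>(\<alpha>, \<beta>) \<in> ?S \<rho>. f \<alpha> * g \<beta>) * h \<gamma>)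
        = (\<Sum>(\<alpha>, \<rho>) \<in> ?S \<delta>. f \<alpha> * (\<Sum>(\<beta>, \<gamma>) \<in> ?S \<rho>. g \<beta> * h \<gamma>))" .
  qed
qed

end

lift_definition mps_const :: "'a::comm_ring_1 \<Rightarrow> 'a mps" is
  "\<lambda>c \<alpha>. if \<alpha> = 0 then c else 0" .

lift_definition mps_var :: "nat \<Rightarrow> 'a::comm_ring_1 mps" is
  "\<lambda>i \<alpha>. if \<alpha> = Poly_Mapping.single i 1 then 1 else 0" .

definition mps_value0 :: "'a mps \<Rightarrow> 'a" where
  "mps_value0 f = mps_coeff f 0"

definition mps_in :: "nat \<Rightarrow> 'a::zero mps set" where
  "mps_in n = {f. \<forall>\<alpha>. mps_coeff f \<alpha> \<noteq> 0 \<longrightarrow> Poly_Mapping.keys \<alpha> \<subseteq> {..<n}}"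

text \<open>
  The composite $f(\Phi_0, \Phi_1, \ldots) = \sum_\alpha f_\alpha \Phi^\alpha$. For \<open>f\<close> in
  \<open>mps_in N\<close> and $\Phi_0, \ldots, \Phi_{N-1}$ vanishing at the origin, only finitely many
  $\alpha$ contribute to a given coefficient; \<open>mps_subst\<close> is only used in this situation.
\<close>

definition mps_subst :: "(nat \<Rightarrow> 'a::comm_ring_1 mps) \<Rightarrow> 'a mps \<Rightarrow> 'a mps" where
  "mps_subst \<Phi> f = Abs_mps (\<lambda>\<beta>. \<Sum>\<alpha>. mps_coeff f \<alpha> *
     mps_coeff (\<Prod>i\<in>Poly_Mapping.keys \<alpha>. \<Phi> i ^ Poly_Mapping.lookup \<alpha> i) \<beta>)"

definition formal_map :: "nat \<Rightarrow> (nat \<Rightarrow> 'a::comm_ring_1 mps) \<Rightarrow> bool" where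
  "formal_map N \<Phi> \<longleftrightarrow> (\<forall>i<N. \<Phi> i \<in> mps_in N \<and> mps_value0 (\<Phi> i) = 0)"

definition coordinate_change :: "nat \<Rightarrow> (nat \<Rightarrow> 'a::comm_ring_1 mps) \<Rightarrow> bool" where
  "coordinate_change N \<Phi> \<longleftrightarrow> formal_map N \<Phi> \<and>
     (\<exists>\<Psi>. formal_map N \<Psi> \<and>
        (\<forall>i<N. mps_subst \<Psi> (\<Phi> i) = mps_var i \<and> mps_subst \<Phi> (\<Psi> i) = mps_var i))"

definition R_equivalent :: "nat \<Rightarrow> 'a::comm_ring_1 mps \<Rightarrow> 'a mps \<Rightarrow> bool" where
  "R_equivalent N f g \<longleftrightarrow> f \<in> mps_in N \<and> g \<in> mps_in N \<and>
     (\<exists>\<Phi>. coordinate_change N \<Phi> \<and> mps_subst \<Phi> f = g)"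

text \<open>
  A quadratic form in \<open>r\<close> variables is given by a symmetric $r \times r$ matrix
  (entries with an index \<open>\<ge> r\<close> play no role); it is non-degenerate if the radical of the
  associated bilinear form is zero. The case \<open>r = 0\<close> is allowed, and \<open>quadratic_form n r A\<close> is
  the form in the variables $x_n, \ldots, x_{n+r-1}$.
\<close>

definition nondegenerate_form :: "nat \<Rightarrow> (nat \<Rightarrow> nat \<Rightarrow> 'a::comm_ring_1) \<Rightarrow> bool" where
  "nondegenerate_form r A \<longleftrightarrow> (\<forall>i<r. \<forall>j<r. A i j = A j i) \<and>
     (\<forall>y. (\<forall>i<r. (\<Sum>j<r. A i j * y j) = 0) \<longrightarrow> (\<forall>j<r. y j = 0))"

definition quadratic_form :: "nat \<Rightarrow> nat \<Rightarrow> (nat \<Rightarrow> nat \<Rightarrow> 'a::comm_ring_1) \<Rightarrow> 'a mps" where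
  "quadratic_form n r A =
     (\<Sum>i<r. \<Sum>j<r. mps_const (A i j) * mps_var (n + i) * mps_var (n + j))"

definition stably_equivalent ::
    "nat \<Rightarrow> 'a::comm_ring_1 mps \<Rightarrow> nat \<Rightarrow> 'a mps \<Rightarrow> bool" where
  "stably_equivalent n f N F \<longleftrightarrow> f \<in> mps_in n \<and> F \<in> mps_in N \<and>
     (\<exists>r s A B. n + r = N + s \<and> nondegenerate_form r A \<and> nondegenerate_form s B \<and>
        R_equivalent (n + r) (f + quadratic_form n r A) (F + quadratic_form N s B))"

text \<open>
  The function $F = -uv + u\varphi + m v^k + g$, with \<open>u\<close> and \<open>v\<close> as arguments:
  for \<open>u = mps_var n\<close>, \<open>v = mps_var (n + 1)\<close> it is the power series of $F$ at the origin. As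
  $F$ is polynomial in $u$ and $v$, it can also be expanded at $(x, u, v) = (0, u_0, v_0)$:
  take \<open>u = mps_var n + mps_const u0\<close>, \<open>v = mps_var (n + 1) + mps_const v0\<close>.

  The point of interest is the one where $\partial F/\partial u = \varphi - v$ and
  $\partial F/\partial v = k m v^{k-1} - u$ vanish over $x = 0$, namely
  $v_0 = \varphi(0)$ and $u_0 = k\,m(0)\,\varphi(0)^{k-1}$; the value of $F$ there is
  $(g + m\varphi^k)(0)$. It is the origin if $\varphi(0) = 0$ and, in case
  $k = 1$, also $m(0) = 0$. Otherwise $F$ has a non-zero linear part in $(u, v)$ at the origin,
  so its germ at the origin is not singular, whatever $g + m\varphi^k$ is.
\<close>

definition uv_function ::
    "nat \<Rightarrow> 'a::comm_ring_1 mps \<Rightarrow> 'a mps \<Rightarrow> 'a mps \<Rightarrow> 'a mps \<Rightarrow> 'a mps \<Rightarrow> 'a mps" where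
  "uv_function k g m \<phi> u v = - (u * v) + u * \<phi> + m * v ^ k + g"

end

theory Submission
  imports Defs
begin

text \<open>
  The function $F = -uv + u\varphi + m v^k + g$ differs from $f = g + m\varphi^k$ by a product of
  two functions that can serve as coordinates in place of $u$ and $v$. Indeed $v - \varphi$ divides
  $v^k - \varphi^k$, say with quotient $h$, so that
  \[ F = f + (v - \varphi)\,(m h - u) . \]
  As $\varphi$ does not involve $v$, and neither $m$ nor $h$ involves $u$, the system
  $a = v - \varphi$, $b = m h - u$ can be solved explicitly, first for $v$ and then for $u$. Hence
  $(x, u, v) \mapsto (x, a, b)$ is a coordinate change, which carries $f$ plus the hyperbolic plane
  $ab$, a non-degenerate quadratic form in two new variables, into $F$. This is
  \<open>R_equivalent_uv_function\<close>; no quadratic form has to be added to $F$.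

  For a coordinate change both $a$ and $b$ must vanish at the base point. For $a$ this means
  $v_0 = \varphi(0)$; then $h(0) = k\,\varphi(0)^{k-1}$, and for $b$ it means
  $u_0 = k\,m(0)\,\varphi(0)^{k-1}$. These are the coordinates of the critical point in
  $(u, v)$, and the expansion at the origin is the special case $u_0 = v_0 = 0$.

  Checking that the two maps are inverse to each other, and that the first one carries $f + ab$
  into $F$, only uses that substitution is a ring homomorphism that fixes the functions of $x$.
  For formal power series this needs an argument, since the composite is an infinite sum: a monomial of degree $e$ in series
  without constant term has order at least $e$; therefore each coefficient of the composite depends
  on finitely many terms.
\<close>

section \<open>Coefficients and the series in finitely many variables\<close>

lemma mps_coeff_zero [simp]: "mps_coeff 0 \<alpha> = 0"
  and mps_coeff_one: "mps_coeff 1 \<alpha> = (if \<alpha> = 0 then 1 else 0)"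
  and mps_coeff_add [simp]: "mps_coeff (f + g) \<alpha> = mps_coeff f \<alpha> + mps_coeff g \<alpha>"
  and mps_coeff_uminus [simp]: "mps_coeff (- f) \<alpha> = - mps_coeff f \<alpha>"
  and mps_coeff_diff [simp]: "mps_coeff (f - g) \<alpha> = mps_coeff f \<alpha> - mps_coeff g \<alpha>"
  and mps_coeff_mult: "mps_coeff (f * g) \<gamma> =
        (\<Sum>(\<alpha>, \<beta>) \<in> {(\<alpha>, \<beta>). \<alpha> + \<beta> = \<gamma>}. mps_coeff f \<alpha> * mps_coeff g \<beta>)"
  and mps_coeff_const: "mps_coeff (mps_const c) \<alpha> = (if \<alpha> = 0 then c else 0)"
  and mps_coeff_var: "mps_coeff (mps_var i) \<alpha> = (if \<alpha> = Poly_Mapping.single i 1 then 1 else 0)"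
  for f g :: "'a::comm_ring_1 mps"
  by (simp_all add: zero_mps.rep_eq one_mps.rep_eq plus_mps.rep_eq uminus_mps.rep_eq
      minus_mps.rep_eq times_mps.rep_eq mps_const.rep_eq mps_var.rep_eq)

lemma mps_const_0 [simp]: "mps_const 0 = 0"
  by (rule mps_eqI) (simp add: mps_coeff_const)

lemma mps_coeff_mult_nonzeroE:
  fixes f g :: "'a::comm_ring_1 mps"
  assumes "mps_coeff (f * g) \<gamma> \<noteq> 0"
  obtains \<alpha> \<beta> where "\<gamma> = \<alpha> + \<beta>" "mps_coeff f \<alpha> \<noteq> 0" "mps_coeff g \<beta> \<noteq> 0"
proof -
  obtain p where "p \<in> {(\<alpha>, \<beta>). \<alpha> + \<beta> = \<gamma>}"
      and "(case p of (\<alpha>, \<beta>) \<Rightarrow> mps_coeff f \<alpha> * mps_coeff g \<beta>) \<noteq> 0"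
    using assms unfolding mps_coeff_mult by (rule sum.not_neutral_contains_not_neutral)
  then have "\<gamma> = fst p + snd p" "mps_coeff f (fst p) \<noteq> 0" "mps_coeff g (snd p) \<noteq> 0"
    by auto
  then show thesis by (rule that)
qed

lemma mps_in_mono: "n \<le> N \<Longrightarrow> f \<in> mps_in n \<Longrightarrow> f \<in> mps_in N"
  by (auto simp: mps_in_def subset_iff intro: less_le_trans)

lemma mps_in_const [simp]: "mps_const c \<in> mps_in n"
  by (auto simp: mps_in_def mps_coeff_const split: if_splits)

lemma mps_in_var [simp]: "i < n \<Longrightarrow> mps_var i \<in> mps_in n"
  by (auto simp: mps_in_def mps_coeff_var split: if_splits)

lemma mps_in_zero [simp]: "(0 :: 'a::comm_ring_1 mps) \<in> mps_in n"
  by (simp add: mps_in_def)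

lemma mps_in_one [simp]: "(1 :: 'a::comm_ring_1 mps) \<in> mps_in n"
  by (auto simp: mps_in_def mps_coeff_one split: if_splits)

lemma mps_in_uminus [simp]: "f \<in> mps_in n \<Longrightarrow> - f \<in> mps_in n"
  for f :: "'a::comm_ring_1 mps"
  by (simp add: mps_in_def)

lemma mps_in_add [simp]: "f \<in> mps_in n \<Longrightarrow> g \<in> mps_in n \<Longrightarrow> f + g \<in> mps_in n"
  for f g :: "'a::comm_ring_1 mps"
  unfolding mps_in_def mem_Collect_eq mps_coeff_add by (metis add_0)

lemma mps_in_diff [simp]: "f \<in> mps_in n \<Longrightarrow> g \<in> mps_in n \<Longrightarrow> f - g \<in> mps_in n"
  for f g :: "'a::comm_ring_1 mps"
  using mps_in_add[of f n "- g"] by simp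

lemma mps_in_mult [simp]: "f \<in> mps_in n \<Longrightarrow> g \<in> mps_in n \<Longrightarrow> f * g \<in> mps_in n"
  for f g :: "'a::comm_ring_1 mps"
  unfolding mps_in_def mem_Collect_eq
proof (intro allI impI)
  fix \<gamma>
  assume "mps_coeff (f * g) \<gamma> \<noteq> 0"
  then obtain \<alpha> \<beta> where "\<gamma> = \<alpha> + \<beta>" "mps_coeff f \<alpha> \<noteq> 0" "mps_coeff g \<beta> \<noteq> 0"
    by (rule mps_coeff_mult_nonzeroE)
  moreover assume "\<forall>\<alpha>. mps_coeff f \<alpha> \<noteq> 0 \<longrightarrow> Poly_Mapping.keys \<alpha> \<subseteq> {..<n}"
    "\<forall>\<alpha>. mps_coeff g \<alpha> \<noteq> 0 \<longrightarrow> Poly_Mapping.keys \<alpha> \<subseteq> {..<n}"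
  ultimately show "Poly_Mapping.keys \<gamma> \<subseteq> {..<n}"
    using Poly_Mapping.keys_add[of \<alpha> \<beta>] by blast
qed

lemma mps_in_power [simp]: "f \<in> mps_in n \<Longrightarrow> f ^ k \<in> mps_in n"
  for f :: "'a::comm_ring_1 mps"
  by (induction k) auto

lemma mps_in_sum [simp]: "(\<And>i. i \<in> A \<Longrightarrow> f i \<in> mps_in n) \<Longrightarrow> sum f A \<in> mps_in n"
  for f :: "'b \<Rightarrow> 'a::comm_ring_1 mps"
  by (induction A rule: infinite_finite_induct) auto

lemma mps_value0_simps [simp]:
  fixes f g :: "'a::comm_ring_1 mps"
  shows "mps_value0 (1 :: 'a mps) = 1"
    and "mps_value0 (0 :: 'a mps) = 0"
    and "mps_value0 (mps_const c) = c"
    and "mps_value0 (mps_var i :: 'a mps) = 0"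
    and "mps_value0 (f + g) = mps_value0 f + mps_value0 g"
    and "mps_value0 (f - g) = mps_value0 f - mps_value0 g"
    and "mps_value0 (f * g) = mps_value0 f * mps_value0 g"
proof -
  have "{(\<alpha>, \<beta>). \<alpha> + \<beta> = (0 :: nat \<Rightarrow>\<^sub>0 nat)} = {(0, 0)}"
    by (auto simp: poly_mapping_eq_iff lookup_add fun_eq_iff)
  then show "mps_value0 (f * g) = mps_value0 f * mps_value0 g"
    by (simp add: mps_value0_def mps_coeff_mult)
  have "Poly_Mapping.single i 1 \<noteq> (0 :: nat \<Rightarrow>\<^sub>0 nat)"
    by (metis lookup_single_eq lookup_zero zero_neq_one)
  then show "mps_value0 (mps_var i :: 'a mps) = 0"
    by (simp add: mps_value0_def mps_coeff_var)
qed (simp_all add: mps_value0_def mps_coeff_one mps_coeff_const)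

lemma mps_value0_power [simp]: "mps_value0 (f ^ k) = mps_value0 f ^ k"
  for f :: "'a::comm_ring_1 mps"
  by (induction k) simp_all

lemma mps_value0_sum [simp]: "mps_value0 (sum f A) = (\<Sum>i\<in>A. mps_value0 (f i))"
  for f :: "'b \<Rightarrow> 'a::comm_ring_1 mps"
  by (induction A rule: infinite_finite_induct) simp_all

section \<open>Total degree and order\<close>

definition total_degree :: "(nat \<Rightarrow>\<^sub>0 nat) \<Rightarrow> nat" where
  "total_degree \<alpha> = (\<Sum>i\<in>Poly_Mapping.keys \<alpha>. Poly_Mapping.lookup \<alpha> i)"

lemma total_degree_superset:
  assumes "finite A" "Poly_Mapping.keys \<alpha> \<subseteq> A"
  shows "total_degree \<alpha> = (\<Sum>i\<in>A. Poly_Mapping.lookup \<alpha> i)"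
  unfolding total_degree_def by (rule sum.mono_neutral_left) (use assms in \<open>auto simp: in_keys_iff\<close>)

lemma keys_add_nat: "Poly_Mapping.keys (\<alpha> + \<beta>) = Poly_Mapping.keys \<alpha> \<union> Poly_Mapping.keys \<beta>"
  for \<alpha> \<beta> :: "nat \<Rightarrow>\<^sub>0 nat"
  by (auto simp: in_keys_iff lookup_add)

lemma total_degree_add: "total_degree (\<alpha> + \<beta>) = total_degree \<alpha> + total_degree \<beta>"
proof -
  let ?A = "Poly_Mapping.keys \<alpha> \<union> Poly_Mapping.keys \<beta>"
  have "total_degree \<gamma> = (\<Sum>i\<in>?A. Poly_Mapping.lookup \<gamma> i)"
    if "Poly_Mapping.keys \<gamma> \<subseteq> ?A" for \<gamma>
    using that by (intro total_degree_superset) auto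
  then show ?thesis
    by (simp add: keys_add_nat lookup_add sum.distrib)
qed

lemma total_degree_eq_0_iff: "total_degree \<alpha> = 0 \<longleftrightarrow> \<alpha> = 0"
  by (auto simp: total_degree_def in_keys_iff poly_mapping_eq_iff fun_eq_iff)

definition exponents_upto :: "nat \<Rightarrow> nat \<Rightarrow> (nat \<Rightarrow>\<^sub>0 nat) set" where
  "exponents_upto N d = {\<alpha>. Poly_Mapping.keys \<alpha> \<subseteq> {..<N} \<and> total_degree \<alpha> \<le> d}"

lemma finite_exponents_upto: "finite (exponents_upto N d)"
proof -
  let ?F = "{e :: nat \<Rightarrow> nat. \<forall>i. (i \<in> {..<N} \<longrightarrow> e i \<in> {..d}) \<and> (i \<notin> {..<N} \<longrightarrow> e i = 0)}"
  have "Poly_Mapping.lookup ` exponents_upto N d \<subseteq> ?F"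
  proof clarify
    fix \<alpha> i
    assume \<alpha>: "\<alpha> \<in> exponents_upto N d"
    have "Poly_Mapping.lookup \<alpha> i \<le> total_degree \<alpha>"
    proof (cases "i \<in> Poly_Mapping.keys \<alpha>")
      case True
      then show ?thesis
        unfolding total_degree_def by (intro member_le_sum) auto
    qed (simp add: in_keys_iff)
    then show "(i \<in> {..<N} \<longrightarrow> Poly_Mapping.lookup \<alpha> i \<in> {..d}) \<and>
        (i \<notin> {..<N} \<longrightarrow> Poly_Mapping.lookup \<alpha> i = 0)"
      using \<alpha> by (auto simp: exponents_upto_def in_keys_iff subset_iff)
  qed
  moreover have "finite ?F"
    by (rule finite_set_of_finite_funs) auto
  ultimately have "finite (Poly_Mapping.lookup ` exponents_upto N d)"
    by (rule finite_subset)
  then show ?thesis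
    by (rule finite_imageD) (auto intro: inj_onI simp: lookup_inject)
qed

definition order_at_least :: "nat \<Rightarrow> 'a::zero mps \<Rightarrow> bool" where
  "order_at_least d f \<longleftrightarrow> (\<forall>\<beta>. mps_coeff f \<beta> \<noteq> 0 \<longrightarrow> d \<le> total_degree \<beta>)"

lemma order_at_least_one: "mps_value0 f = 0 \<Longrightarrow> order_at_least 1 f"
  unfolding order_at_least_def mps_value0_def
  by (metis One_nat_def Suc_leI neq0_conv total_degree_eq_0_iff)

lemma order_at_least_mult:
  fixes f g :: "'a::comm_ring_1 mps"
  assumes "order_at_least d f" "order_at_least e g"
  shows "order_at_least (d + e) (f * g)"
  unfolding order_at_least_def
  by (metis assms add_mono mps_coeff_mult_nonzeroE order_at_least_def total_degree_add)

lemma order_at_least_power: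
  fixes f :: "'a::comm_ring_1 mps"
  assumes "mps_value0 f = 0"
  shows "order_at_least e (f ^ e)"
proof (induction e)
  case 0
  show ?case by (simp add: order_at_least_def)
next
  case (Suc e)
  then show ?case
    using order_at_least_mult[OF order_at_least_one[OF assms] Suc] by simp
qed

lemma order_at_least_prod:
  fixes f :: "'b \<Rightarrow> 'a::comm_ring_1 mps"
  assumes "\<And>i. i \<in> A \<Longrightarrow> order_at_least (e i) (f i)"
  shows "order_at_least (sum e A) (prod f A)"
  using assms
proof (induction A rule: infinite_finite_induct)
  case (insert i A)
  then show ?case by (simp add: order_at_least_mult)
qed (simp_all add: order_at_least_def)

section \<open>Substitution is a ring homomorphism\<close>

definition mps_monom_subst :: "(nat \<Rightarrow> 'a::comm_ring_1 mps) \<Rightarrow> (nat \<Rightarrow>\<^sub>0 nat) \<Rightarrow> 'a mps" where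
  "mps_monom_subst \<Phi> \<alpha> = (\<Prod>i\<in>Poly_Mapping.keys \<alpha>. \<Phi> i ^ Poly_Mapping.lookup \<alpha> i)"

lemma mps_monom_subst_superset:
  assumes "finite A" "Poly_Mapping.keys \<alpha> \<subseteq> A"
  shows "mps_monom_subst \<Phi> \<alpha> = (\<Prod>i\<in>A. \<Phi> i ^ Poly_Mapping.lookup \<alpha> i)"
  unfolding mps_monom_subst_def
  by (rule prod.mono_neutral_left) (use assms in \<open>auto simp: in_keys_iff\<close>)

lemma mps_monom_subst_add:
  "mps_monom_subst \<Phi> (\<alpha> + \<beta>) = mps_monom_subst \<Phi> \<alpha> * mps_monom_subst \<Phi> \<beta>"
proof -
  let ?A = "Poly_Mapping.keys \<alpha> \<union> Poly_Mapping.keys \<beta>"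
  have "mps_monom_subst \<Phi> \<gamma> = (\<Prod>i\<in>?A. \<Phi> i ^ Poly_Mapping.lookup \<gamma> i)"
    if "Poly_Mapping.keys \<gamma> \<subseteq> ?A" for \<gamma>
    using that by (intro mps_monom_subst_superset) auto
  then show ?thesis
    by (simp add: keys_add_nat lookup_add power_add prod.distrib)
qed

lemma mps_coeff_subst:
  "mps_coeff (mps_subst \<Phi> f) \<beta> = (\<Sum>\<alpha>. mps_coeff f \<alpha> * mps_coeff (mps_monom_subst \<Phi> \<alpha>) \<beta>)"
  by (simp add: mps_subst_def Abs_mps_inverse mps_monom_subst_def)

text \<open>
  Each factor $\Phi_i$ has order at least one. This bound is what makes the sum that defines
  \<open>mps_subst\<close> finite in every coefficient.
\<close>

lemma mps_coeff_monom_subst_eq_0: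
  assumes "formal_map N \<Phi>" "Poly_Mapping.keys \<alpha> \<subseteq> {..<N}" "total_degree \<beta> < total_degree \<alpha>"
  shows "mps_coeff (mps_monom_subst \<Phi> \<alpha>) \<beta> = 0"
proof -
  have "order_at_least (total_degree \<alpha>) (mps_monom_subst \<Phi> \<alpha>)"
    unfolding total_degree_def mps_monom_subst_def
    by (intro order_at_least_prod order_at_least_power)
      (use assms(1,2) in \<open>auto simp: formal_map_def\<close>)
  then show ?thesis
    using assms(3) by (auto simp: order_at_least_def)
qed

text \<open>
  The bound \<open>d\<close> may exceed the degree of \<open>\<beta>\<close>, so that the coefficients at several \<open>\<beta>\<close> can be
  summed over a common range of exponents.
\<close>

lemma mps_coeff_subst_finite:
  assumes "formal_map N \<Phi>" "f \<in> mps_in N" "total_degree \<beta> \<le> d"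
  shows "mps_coeff (mps_subst \<Phi> f) \<beta> =
    (\<Sum>\<alpha>\<in>exponents_upto N d. mps_coeff f \<alpha> * mps_coeff (mps_monom_subst \<Phi> \<alpha>) \<beta>)"
  unfolding mps_coeff_subst
proof (rule Sum_any.expand_superset[OF finite_exponents_upto], clarify)
  fix \<alpha>
  assume nz: "mps_coeff f \<alpha> * mps_coeff (mps_monom_subst \<Phi> \<alpha>) \<beta> \<noteq> 0"
  then have keys: "Poly_Mapping.keys \<alpha> \<subseteq> {..<N}"
    using assms(2) unfolding mps_in_def by force
  then have "\<not> total_degree \<beta> < total_degree \<alpha>"
    using mps_coeff_monom_subst_eq_0[OF assms(1)] nz by force
  with keys show "\<alpha> \<in> exponents_upto N d"
    using assms(3) by (auto simp: exponents_upto_def)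
qed

lemma mps_subst_add:
  assumes "formal_map N \<Phi>" "f \<in> mps_in N" "g \<in> mps_in N"
  shows "mps_subst \<Phi> (f + g) = mps_subst \<Phi> f + mps_subst \<Phi> g"
  by (rule mps_eqI)
    (use assms in \<open>simp add: mps_coeff_subst_finite[OF _ _ order_refl] distrib_right sum.distrib\<close>)

text \<open>
  Both sides expand, at \<open>\<gamma>\<close>, into sums of $f_\alpha\, g_\beta\, (\Phi^{\alpha + \beta})_\gamma$. On the
  left the pairs $(\alpha, \beta)$ are restricted by the degree of $\alpha + \beta$, on the right by
  the degrees of $\alpha$ and of $\beta$; the additional terms on the right vanish.
\<close>

lemma mps_subst_mult:
  assumes \<Phi>: "formal_map N \<Phi>" and f: "f \<in> mps_in N" and g: "g \<in> mps_in N"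
  shows "mps_subst \<Phi> (f * g) = mps_subst \<Phi> f * mps_subst \<Phi> g"
proof (rule mps_eqI)
  fix \<gamma> :: "nat \<Rightarrow>\<^sub>0 nat"
  define D where "D = exponents_upto N (total_degree \<gamma>)"
  let ?S = "\<lambda>\<gamma> :: nat \<Rightarrow>\<^sub>0 nat. {(\<alpha>, \<beta>). \<alpha> + \<beta> = \<gamma>}"
  let ?M = "mps_monom_subst \<Phi>"
  let ?t = "\<lambda>(\<alpha>, \<beta>). mps_coeff f \<alpha> * mps_coeff g \<beta> * mps_coeff (?M (\<alpha> + \<beta>)) \<gamma>"
  have fin: "finite D" "\<And>\<delta>. finite (?S \<delta>)"
    by (simp_all add: D_def finite_exponents_upto finite_exponent_splittings)
  have D_add: "\<alpha> + \<beta> \<in> D \<Longrightarrow> \<alpha> \<in> D \<and> \<beta> \<in> D" for \<alpha> \<beta>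
    by (auto simp: D_def exponents_upto_def keys_add_nat total_degree_add)
  have "mps_coeff (mps_subst \<Phi> (f * g)) \<gamma> = (\<Sum>\<delta>\<in>D. mps_coeff (f * g) \<delta> * mps_coeff (?M \<delta>) \<gamma>)"
    using \<Phi> f g by (simp add: mps_coeff_subst_finite[OF _ _ order_refl] D_def)
  also have "\<dots> = (\<Sum>\<delta>\<in>D. \<Sum>p\<in>?S \<delta>. ?t p)"
    by (auto simp: mps_coeff_mult sum_distrib_right case_prod_unfold intro!: sum.cong)
  also have "\<dots> = (\<Sum>(\<delta>, p)\<in>Sigma D ?S. ?t p)"
    by (rule sum.Sigma) (use fin in auto)
  also have "\<dots> = sum ?t {p. fst p + snd p \<in> D}"
    by (rule sum.reindex_bij_witness[of _ "\<lambda>p. (fst p + snd p, p)" snd]) auto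
  \<comment> \<open>A pair of exponents in \<open>D\<close> whose sum is not in \<open>D\<close> has total degree too large to
    contribute to the coefficient at \<open>\<gamma>\<close>.\<close>
  also have "\<dots> = sum ?t (D \<times> D)"
  proof (rule sum.mono_neutral_left)
    show "\<forall>p\<in>D \<times> D - {p. fst p + snd p \<in> D}. ?t p = 0"
    proof
      fix p
      assume "p \<in> D \<times> D - {p. fst p + snd p \<in> D}"
      then obtain \<alpha> \<beta> where p: "p = (\<alpha>, \<beta>)" and "\<alpha> \<in> D" "\<beta> \<in> D" "\<alpha> + \<beta> \<notin> D"
        by (cases p) auto
      then have "mps_coeff (?M (\<alpha> + \<beta>)) \<gamma> = 0"
        by (intro mps_coeff_monom_subst_eq_0[OF \<Phi>])
          (auto simp: D_def exponents_upto_def keys_add_nat)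
      then show "?t p = 0"
        by (simp add: p)
    qed
  qed (use fin in \<open>auto dest: D_add\<close>)
  also have "\<dots> = (\<Sum>(\<alpha>, \<beta>)\<in>D \<times> D. \<Sum>q\<in>?S \<gamma>.
      (mps_coeff f \<alpha> * mps_coeff (?M \<alpha>) (fst q)) * (mps_coeff g \<beta> * mps_coeff (?M \<beta>) (snd q)))"
    by (rule sum.cong)
      (auto simp: mps_monom_subst_add mps_coeff_mult sum_distrib_left case_prod_unfold ac_simps)
  also have "\<dots> = (\<Sum>q\<in>?S \<gamma>. \<Sum>(\<alpha>, \<beta>)\<in>D \<times> D.
      (mps_coeff f \<alpha> * mps_coeff (?M \<alpha>) (fst q)) * (mps_coeff g \<beta> * mps_coeff (?M \<beta>) (snd q)))"
    unfolding case_prod_unfold by (rule sum.swap)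
  also have "\<dots> = (\<Sum>q\<in>?S \<gamma>. (\<Sum>\<alpha>\<in>D. mps_coeff f \<alpha> * mps_coeff (?M \<alpha>) (fst q)) *
      (\<Sum>\<beta>\<in>D. mps_coeff g \<beta> * mps_coeff (?M \<beta>) (snd q)))"
    by (simp only: sum_product sum.cartesian_product)
  also have "\<dots> = (\<Sum>q\<in>?S \<gamma>. mps_coeff (mps_subst \<Phi> f) (fst q) * mps_coeff (mps_subst \<Phi> g) (snd q))"
  proof (rule sum.cong[OF refl])
    fix q
    assume "q \<in> ?S \<gamma>"
    then have "total_degree (fst q) \<le> total_degree \<gamma>" "total_degree (snd q) \<le> total_degree \<gamma>"
      by (auto simp: total_degree_add)
    then show "(\<Sum>\<alpha>\<in>D. mps_coeff f \<alpha> * mps_coeff (?M \<alpha>) (fst q)) *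
        (\<Sum>\<beta>\<in>D. mps_coeff g \<beta> * mps_coeff (?M \<beta>) (snd q)) =
        mps_coeff (mps_subst \<Phi> f) (fst q) * mps_coeff (mps_subst \<Phi> g) (snd q)"
      using \<Phi> f g by (simp add: mps_coeff_subst_finite D_def)
  qed
  also have "\<dots> = mps_coeff (mps_subst \<Phi> f * mps_subst \<Phi> g) \<gamma>"
    by (simp add: mps_coeff_mult case_prod_unfold)
  finally show "mps_coeff (mps_subst \<Phi> (f * g)) \<gamma> = mps_coeff (mps_subst \<Phi> f * mps_subst \<Phi> g) \<gamma>" .
qed

lemma mps_subst_var: "mps_subst \<Phi> (mps_var i) = \<Phi> i"
proof (rule mps_eqI)
  fix \<beta>
  have "mps_coeff (mps_subst \<Phi> (mps_var i)) \<beta> = (\<Sum>\<alpha>\<in>{Poly_Mapping.single i 1}.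
      mps_coeff (mps_var i) \<alpha> * mps_coeff (mps_monom_subst \<Phi> \<alpha>) \<beta>)"
    unfolding mps_coeff_subst
    by (rule Sum_any.expand_superset) (auto simp: mps_coeff_var split: if_splits)
  then show "mps_coeff (mps_subst \<Phi> (mps_var i)) \<beta> = mps_coeff (\<Phi> i) \<beta>"
    by (simp add: mps_coeff_var mps_monom_subst_def)
qed

lemma mps_coeff_monom_subst_var:
  "mps_coeff (mps_monom_subst mps_var \<alpha> :: 'a::comm_ring_1 mps) \<beta> = (if \<beta> = \<alpha> then 1 else 0)"
proof -
  have coeff_mult: "mps_coeff (f * g) \<beta> = (if \<beta> = \<delta> + \<epsilon> then 1 else 0)"
    if "\<And>\<beta>. mps_coeff f \<beta> = (if \<beta> = \<delta> then 1 else 0)"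
       "\<And>\<beta>. mps_coeff g \<beta> = (if \<beta> = \<epsilon> then 1 else 0)"
    for f g :: "'a mps" and \<delta> \<epsilon> \<beta>
  proof -
    have "mps_coeff (f * g) \<beta> =
        (\<Sum>p \<in> {(\<alpha>, \<beta>'). \<alpha> + \<beta>' = \<beta>}. if p = (\<delta>, \<epsilon>) then 1 else 0)"
      unfolding mps_coeff_mult by (rule sum.cong) (auto simp: that split: if_split_asm)
    also have "\<dots> = (if (\<delta>, \<epsilon>) \<in> {(\<alpha>, \<beta>'). \<alpha> + \<beta>' = \<beta>} then 1 else 0)"
      by (rule sum.delta[OF finite_exponent_splittings])
    finally show ?thesis
      by auto
  qed
  have power: "mps_coeff (mps_var i ^ e :: 'a mps) \<beta> =
      (if \<beta> = Poly_Mapping.single i e then 1 else 0)" for i e \<beta>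
  proof (induction e arbitrary: \<beta>)
    case 0
    show ?case by (simp add: mps_coeff_one)
  next
    case (Suc e)
    have "Poly_Mapping.single i (Suc e) = Poly_Mapping.single i 1 + Poly_Mapping.single i e"
      by (simp flip: single_add)
    then show ?case
      unfolding power_Suc by (simp only: coeff_mult[OF mps_coeff_var Suc])
  qed
  have prod: "mps_coeff (\<Prod>i\<in>A. mps_var i ^ e i :: 'a mps) \<beta> =
      (if \<beta> = (\<Sum>i\<in>A. Poly_Mapping.single i (e i)) then 1 else 0)" if "finite A" for A e \<beta>
    using that
  proof (induction A arbitrary: \<beta>)
    case empty
    show ?case by (simp add: mps_coeff_one)
  next
    case (insert i A)
    then show ?case
      using coeff_mult[OF power insert.IH] by simp
  qed
  have "(\<Sum>i\<in>Poly_Mapping.keys \<alpha>. Poly_Mapping.single i (Poly_Mapping.lookup \<alpha> i)) = \<alpha>"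
    by (rule poly_mapping_eqI)
      (simp add: lookup_sum lookup_single when_def in_keys_iff sum.delta)
  then show ?thesis
    by (simp add: mps_monom_subst_def prod)
qed

text \<open>
  The values of \<open>\<Phi>\<close> at indices \<open>\<ge> n\<close> are arbitrary: this is how a change of the additional
  variables leaves the functions of $x_0, \ldots, x_{n-1}$ unchanged. For \<open>n = 0\<close> it evaluates
  substitution in constants.
\<close>

lemma mps_subst_fixes:
  assumes \<Phi>: "\<And>i. i < n \<Longrightarrow> \<Phi> i = mps_var i" and f: "f \<in> mps_in n"
  shows "mps_subst \<Phi> f = f"
proof (rule mps_eqI)
  fix \<beta>
  have coeff: "mps_coeff f \<alpha> * mps_coeff (mps_monom_subst \<Phi> \<alpha>) \<beta> =
      (if \<alpha> = \<beta> then mps_coeff f \<alpha> else 0)" for \<alpha>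
  proof (cases "mps_coeff f \<alpha> = 0")
    case False
    then have "Poly_Mapping.keys \<alpha> \<subseteq> {..<n}"
      using f by (simp add: mps_in_def)
    then have "mps_monom_subst \<Phi> \<alpha> = mps_monom_subst mps_var \<alpha>"
      unfolding mps_monom_subst_def by (intro prod.cong) (auto simp: \<Phi>)
    then show ?thesis
      by (simp add: mps_coeff_monom_subst_var)
  qed auto
  have "mps_coeff (mps_subst \<Phi> f) \<beta> = (\<Sum>\<alpha>\<in>{\<beta>}. if \<alpha> = \<beta> then mps_coeff f \<alpha> else 0)"
    unfolding mps_coeff_subst coeff by (rule Sum_any.expand_superset) auto
  then show "mps_coeff (mps_subst \<Phi> f) \<beta> = mps_coeff f \<beta>"
    by simp
qed

lemma mps_subst_const: "mps_subst \<Phi> (mps_const c) = mps_const c"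
  by (rule mps_subst_fixes[of 0]) simp_all

lemma mps_subst_diff:
  assumes "formal_map N \<Phi>" "f \<in> mps_in N" "g \<in> mps_in N"
  shows "mps_subst \<Phi> (f - g) = mps_subst \<Phi> f - mps_subst \<Phi> g"
  using mps_subst_add[of N \<Phi> "f - g" g] assms by (simp add: eq_diff_eq)

lemma mps_subst_power:
  assumes "formal_map N \<Phi>" "f \<in> mps_in N"
  shows "mps_subst \<Phi> (f ^ k) = mps_subst \<Phi> f ^ k"
proof (induction k)
  case 0
  show ?case by (simp add: mps_subst_fixes[of 0])
next
  case (Suc k)
  then show ?case using assms by (simp add: mps_subst_mult)
qed

lemma mps_subst_sum:
  assumes "formal_map N \<Phi>" "\<And>i. i \<in> A \<Longrightarrow> f i \<in> mps_in N"
  shows "mps_subst \<Phi> (sum f A) = (\<Sum>i\<in>A. mps_subst \<Phi> (f i))"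
  using assms(2)
  by (induction A rule: infinite_finite_induct)
    (simp_all add: mps_subst_fixes[of 0] mps_subst_add[OF assms(1)])

section \<open>The coordinate change\<close>

text \<open>
  The quotient of $x^k - y^k$ by $x - y$, written as a sum so that it is also defined where
  $x - y$ is not invertible.
\<close>

definition power_diff_quotient :: "nat \<Rightarrow> 'a::comm_ring_1 \<Rightarrow> 'a \<Rightarrow> 'a" where
  "power_diff_quotient k x y = (\<Sum>i<k. y ^ (k - Suc i) * x ^ i)"

lemma uv_function_eq:
  "uv_function k g m \<phi> u v =
    g + m * \<phi> ^ k + (v - \<phi>) * (m * power_diff_quotient k v \<phi> - u)"
proof -
  have v: "v ^ k = \<phi> ^ k + (v - \<phi>) * power_diff_quotient k v \<phi>"
    unfolding power_diff_quotient_def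
    by (metis power_diff_sumr2 add_diff_cancel_left' diff_add_cancel add.commute)
  show ?thesis
    unfolding uv_function_def v by (simp add: algebra_simps)
qed

lemma mps_in_power_diff_quotient [simp]:
  "x \<in> mps_in N \<Longrightarrow> y \<in> mps_in N \<Longrightarrow> power_diff_quotient k x y \<in> mps_in N"
  by (simp add: power_diff_quotient_def)

text \<open>
  On the diagonal the difference quotient becomes the derivative of $y^k$; this is where the
  coordinate $u_0$ of the critical point comes from.
\<close>

lemma mps_value0_power_diff_quotient:
  assumes "mps_value0 x = mps_value0 y"
  shows "mps_value0 (power_diff_quotient k x y) = of_nat k * mps_value0 y ^ (k - 1)"
proof -
  have "mps_value0 (power_diff_quotient k x y) = (\<Sum>i<k. mps_value0 y ^ (k - 1))"
    unfolding power_diff_quotient_def mps_value0_sum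
    by (rule sum.cong) (auto simp: assms simp flip: power_add)
  then show ?thesis by simp
qed

lemma mps_subst_power_diff_quotient:
  assumes "formal_map N \<Phi>" "x \<in> mps_in N" "y \<in> mps_in N"
  shows "mps_subst \<Phi> (power_diff_quotient k x y) =
    power_diff_quotient k (mps_subst \<Phi> x) (mps_subst \<Phi> y)"
  using assms
  by (simp add: power_diff_quotient_def mps_subst_sum[OF assms(1)] mps_subst_mult[OF assms(1)]
      mps_subst_power[OF assms(1)])

text \<open>
  Here \<open>U\<close> and \<open>V\<close> are the functions $u$ and $v$ in coordinates centred at the critical point.
  The map \<open>\<Phi>\<close> replaces $x_n$ by $V - \varphi$ and $x_{n+1}$ by $m h - U$. Its inverse \<open>\<Psi>\<close>
  solves for $V = x_n + \varphi$ and then for $U = m h - x_{n+1}$, with $h$ evaluated at this $V$,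
  and shifts back by $v_0$ and $u_0$.
\<close>

lemma R_equivalent_uv_function:
  fixes g m \<phi> :: "'a::comm_ring_1 mps" and n k :: nat
  assumes g: "g \<in> mps_in n" and m: "m \<in> mps_in n" and \<phi>: "\<phi> \<in> mps_in n"
  defines "u0 \<equiv> of_nat k * mps_value0 m * mps_value0 \<phi> ^ (k - 1)"
    and "v0 \<equiv> mps_value0 \<phi>"
  shows "R_equivalent (n + 2) (g + m * \<phi> ^ k + mps_var n * mps_var (n + 1))
    (uv_function k g m \<phi> (mps_var n + mps_const u0) (mps_var (n + 1) + mps_const v0))"
proof -
  define N where "N = n + 2"
  let ?q = "power_diff_quotient k"
  define U V where "U = (mps_var n + mps_const u0 :: 'a mps)"
    and "V = (mps_var (n + 1) + mps_const v0 :: 'a mps)"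
  define \<Phi> where "\<Phi> i = (if i = n then V - \<phi> else if i = n + 1 then m * ?q V \<phi> - U
    else mps_var i)" for i
  define \<Psi> where "\<Psi> i = (if i = n then m * ?q (mps_var n + \<phi>) \<phi> - mps_var (n + 1) - mps_const u0
    else if i = n + 1 then mps_var n + \<phi> - mps_const v0 else mps_var i)" for i
  have [simp]: "n < N" "Suc n < N"
    by (simp_all add: N_def)
  have [simp]: "g \<in> mps_in N" "m \<in> mps_in N" "\<phi> \<in> mps_in N" "U \<in> mps_in N" "V \<in> mps_in N"
    using g m \<phi> mps_in_mono[of n N] by (simp_all add: U_def V_def N_def)
  have fm: "formal_map N \<Phi>" "formal_map N \<Psi>"
    by (auto simp: formal_map_def \<Phi>_def \<Psi>_def mps_value0_power_diff_quotient V_def U_def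
        u0_def v0_def)
  have unchanged: "mps_subst \<Phi> f = f" "mps_subst \<Psi> f = f" if "f \<in> mps_in n" for f
    using that by (auto simp: \<Phi>_def \<Psi>_def intro!: mps_subst_fixes[of n])
  note hom = mps_subst_add mps_subst_diff mps_subst_mult mps_subst_power_diff_quotient
  note eval = hom[OF fm(1)] hom[OF fm(2)] mps_subst_var mps_subst_const
    unchanged[OF m] unchanged[OF \<phi>]
  have "mps_subst \<Psi> (\<Phi> i) = mps_var i \<and> mps_subst \<Phi> (\<Psi> i) = mps_var i" if i: "i < N" for i
  proof -
    have U: "mps_subst \<Psi> U = \<Psi> n + mps_const u0"
      and V: "mps_subst \<Psi> V = mps_var n + \<phi>"
      by (simp_all add: U_def V_def eval) (simp add: \<Psi>_def)
    consider "i < n" | "i = n" | "i = n + 1" using i unfolding N_def by linarith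
    then show ?thesis
    proof cases
      case 1
      then show ?thesis by (simp add: \<Phi>_def \<Psi>_def unchanged)
    next
      case 2
      have "mps_subst \<Psi> (\<Phi> n) = mps_var n"
        by (simp add: \<Phi>_def eval V)
      moreover have "mps_subst \<Phi> (\<Psi> n) = mps_var n"
        by (simp add: \<Psi>_def eval) (simp add: \<Phi>_def U_def)
      ultimately show ?thesis using 2 by simp
    next
      case 3
      have "mps_subst \<Psi> (\<Phi> (n + 1)) = mps_var (n + 1)"
        by (simp add: \<Phi>_def eval U V) (simp add: \<Psi>_def)
      moreover have "mps_subst \<Phi> (\<Psi> (n + 1)) = mps_var (n + 1)"
        by (simp add: \<Psi>_def eval) (simp add: \<Phi>_def V_def)
      ultimately show ?thesis using 3 by simp
    qed
  qed
  then have "coordinate_change N \<Phi>"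
    unfolding coordinate_change_def using fm by blast
  moreover have "mps_subst \<Phi> (g + m * \<phi> ^ k + mps_var n * mps_var (n + 1)) =
      uv_function k g m \<phi> U V"
    unfolding uv_function_eq
    by (simp add: eval unchanged[OF g] mps_subst_power[OF fm(1)]) (simp add: \<Phi>_def)
  moreover have "uv_function k g m \<phi> U V \<in> mps_in N"
    by (simp add: uv_function_def)
  ultimately show ?thesis
    unfolding R_equivalent_def N_def[symmetric] U_def[symmetric] V_def[symmetric] by auto
qed

text \<open>
  The symmetric matrix of the form $ab$ in two variables. Here the characteristic matters:
  the entries off the diagonal are one half.
\<close>

definition hyperbolic_form :: "nat \<Rightarrow> nat \<Rightarrow> 'a::field_char_0" where
  "hyperbolic_form i j = (if i = j then 0 else 1 / 2)"

lemma nondegenerate_hyperbolic_form: "nondegenerate_form 2 hyperbolic_form"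
  by (auto simp: nondegenerate_form_def hyperbolic_form_def numeral_2_eq_2 less_Suc_eq)

lemma quadratic_form_hyperbolic:
  "quadratic_form n 2 hyperbolic_form = mps_var n * mps_var (n + 1)"
proof -
  have half: "mps_const (1 / 2) + mps_const (1 / 2) = (1 :: 'a mps)"
    by (rule mps_eqI, simp only: mps_coeff_add mps_coeff_const mps_coeff_one) simp
  have "quadratic_form n 2 hyperbolic_form =
      (mps_const (1 / 2) + mps_const (1 / 2)) * (mps_var n * mps_var (n + 1) :: 'a mps)"
    by (simp add: quadratic_form_def hyperbolic_form_def numeral_2_eq_2 algebra_simps)
  then show ?thesis by (simp only: half mult_1)
qed

lemma stably_equivalent_uv_function:
  fixes g m \<phi> :: "'a::field_char_0 mps" and n k :: nat
  assumes "g \<in> mps_in n" "m \<in> mps_in n" "\<phi> \<in> mps_in n"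
  shows "stably_equivalent n (g + m * \<phi> ^ k) (n + 2)
    (uv_function k g m \<phi>
      (mps_var n + mps_const (of_nat k * mps_value0 m * mps_value0 \<phi> ^ (k - 1)))
      (mps_var (n + 1) + mps_const (mps_value0 \<phi>)))"
    (is "stably_equivalent _ ?f _ ?F")
proof -
  have "R_equivalent (n + 2) (?f + quadratic_form n 2 hyperbolic_form)
      (?F + quadratic_form (n + 2) 0 (\<lambda>_ _. 0))"
    using R_equivalent_uv_function[OF assms, of k]
    by (simp add: quadratic_form_hyperbolic) (simp add: quadratic_form_def)
  moreover have "?f \<in> mps_in n"
    using assms by simp
  moreover have "?F \<in> mps_in (n + 2)"
    using R_equivalent_uv_function[OF assms, of k] by (simp add: R_equivalent_def)
  moreover have "nondegenerate_form 0 (\<lambda>_ _. 0 :: 'a)"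
    by (simp add: nondegenerate_form_def)
  ultimately show ?thesis
    unfolding stably_equivalent_def using nondegenerate_hyperbolic_form
    by (metis add_0_right)
qed

theorem lemma3p1:
  fixes g m \<phi> :: "'a::{alg_closed_field, field_char_0} mps"
    and n k :: nat
  assumes "k \<ge> 1"
    and "g \<in> mps_in n" and "m \<in> mps_in n" and "\<phi> \<in> mps_in n"
    and "mps_value0 (g + m * \<phi> ^ k) = 0"
  shows "(mps_value0 \<phi> = 0 \<and> (k \<ge> 2 \<or> mps_value0 m = 0) \<longrightarrow>
           stably_equivalent n (g + m * \<phi> ^ k) (n + 2)
             (uv_function k g m \<phi> (mps_var n) (mps_var (n + 1)))) \<and>
         stably_equivalent n (g + m * \<phi> ^ k) (n + 2)
           (uv_function k g m \<phi>
             (mps_var n + mps_const (of_nat k * mps_value0 m * mps_value0 \<phi> ^ (k - 1)))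
             (mps_var (n + 1) + mps_const (mps_value0 \<phi>)))"
proof (intro conjI impI)
  show critical: "stably_equivalent n (g + m * \<phi> ^ k) (n + 2)
           (uv_function k g m \<phi>
             (mps_var n + mps_const (of_nat k * mps_value0 m * mps_value0 \<phi> ^ (k - 1)))
             (mps_var (n + 1) + mps_const (mps_value0 \<phi>)))"
    using assms(2-4) by (rule stably_equivalent_uv_function)
  assume at_origin: "mps_value0 \<phi> = 0 \<and> (k \<ge> 2 \<or> mps_value0 m = 0)"
  then have u0: "of_nat k * mps_value0 m * mps_value0 \<phi> ^ (k - 1) = 0"
    by (auto simp: power_0_left)
  show "stably_equivalent n (g + m * \<phi> ^ k) (n + 2)
             (uv_function k g m \<phi> (mps_var n) (mps_var (n + 1)))"
    using critical[unfolded u0] at_origin by simp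
qed

end
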